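(* Let $G_1,G_2$ be graphs with $n_1,n_2$ vertices. For $i=1,2$ let $\lambda_1(G_i)\le\cdots\le\lambda_{n_i}(G_i)$ be the Laplacian eigenvalues of $G_i$ with corresponding mutually orthogonal real unit eigenvectors $z_1(G_i),\dots,z_{n_i}(G_i)$, where $z_1(G_i)=\frac{1}{\sqrt{n_i}}\mathbf 1$. Suppose the Cartesian product $G_1\square G_2$ is connected. Then the biharmonic distance in $G_1\square G_2$ between vertices $u_1u_2$ and $v_1v_2$ is $$\Big(\sum_{\substack{1\le i\le n_1,\ 1\le j\le n_2\\ (i,j)\ne(1,1)}}(\lambda_i(G_1)+\lambda_j(G_2))^{-2}\big(z_i(G_1)(u_1)z_j(G_2)(u_2)-z_i(G_1)(v_1)z_j(G_2)(v_2)\big)^2\Big)^{1/2}.$$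
   Context: All graphs are finite, simple and undirected. The Laplacian matrix of a graph is $L=D-A$ ($A$ adjacency matrix, $D$ diagonal degree matrix). For a graph $H$ with Laplacian $L$, $L^{+}$ is the Moore–Penrose inverse and $L^{2+}=(L^{+})^2$; the biharmonic distance in $H$ is the nonnegative number $d_B(u,v)$ with $d_B^2(u,v)=L^{2+}_{uu}+L^{2+}_{vv}-2L^{2+}_{uv}$. The Cartesian product $G_1\square G_2$ has vertex set $\{u_1u_2: u_1\in V(G_1),u_2\in V(G_2)\}$, with $u_1u_2$ adjacent to $v_1v_2$ iff ($u_1=v_1$ and $u_2v_2\in E(G_2)$) or ($u_2=v_2$ and $u_1v_1\in E(G_1)$). The value $z_i(G_1)(u_1)z_j(G_2)(u_2)$ is the $u_1u_2$-coordinate of the Kronecker product $z_i(G_1)\otimes z_j(G_2)$. *)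

theory Defs
  imports "HOL-Analysis.Analysis"
begin

text \<open>
  A graph is an adjacency relation on a finite vertex type; the vertex set is the whole type, so
  the number of vertices of a graph on \<open>'a\<close> is \<open>CARD('a)\<close>.
\<close>

definition simple_graph :: "('a::finite \<Rightarrow> 'a \<Rightarrow> bool) \<Rightarrow> bool" where
  "simple_graph E \<longleftrightarrow> symp E \<and> irreflp E"

definition connected_graph :: "('a::finite \<Rightarrow> 'a \<Rightarrow> bool) \<Rightarrow> bool" where
  "connected_graph E \<longleftrightarrow> (\<forall>u v. rtranclp E u v)"

definition cartesian_product ::
    "('a::finite \<Rightarrow> 'a \<Rightarrow> bool) \<Rightarrow> ('b::finite \<Rightarrow> 'b \<Rightarrow> bool) \<Rightarrow> 'a \<times> 'b \<Rightarrow> 'a \<times> 'b \<Rightarrow> bool" where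
  "cartesian_product E1 E2 = (\<lambda>(u1, u2) (v1, v2). (u1 = v1 \<and> E2 u2 v2) \<or> (u2 = v2 \<and> E1 u1 v1))"

definition adjacency_matrix :: "('a::finite \<Rightarrow> 'a \<Rightarrow> bool) \<Rightarrow> real ^ 'a ^ 'a" where
  "adjacency_matrix E = (\<chi> u v. if E u v then 1 else 0)"

definition degree_matrix :: "('a::finite \<Rightarrow> 'a \<Rightarrow> bool) \<Rightarrow> real ^ 'a ^ 'a" where
  "degree_matrix E = (\<chi> u v. if u = v then real (card {w. E u w}) else 0)"

definition laplacian :: "('a::finite \<Rightarrow> 'a \<Rightarrow> bool) \<Rightarrow> real ^ 'a ^ 'a" where
  "laplacian E = degree_matrix E - adjacency_matrix E"

text \<open>The four Penrose equations, which have exactly one solution for every real matrix.\<close>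

definition is_moore_penrose_inverse :: "real ^ 'n ^ 'm \<Rightarrow> real ^ 'm ^ 'n \<Rightarrow> bool" where
  "is_moore_penrose_inverse A X \<longleftrightarrow>
     A ** X ** A = A \<and> X ** A ** X = X \<and>
     transpose (A ** X) = A ** X \<and> transpose (X ** A) = X ** A"

definition moore_penrose_inverse :: "real ^ 'n ^ 'm \<Rightarrow> real ^ 'm ^ 'n" where
  "moore_penrose_inverse A = (THE X. is_moore_penrose_inverse A X)"

text \<open>
  The radicand below is nonnegative: the pseudoinverse \<open>P\<close> of the (symmetric) Laplacian is
  symmetric, and the radicand is the squared norm of \<open>P (e\<^sub>u - e\<^sub>v)\<close>.
\<close>

definition biharmonic_distance :: "('a::finite \<Rightarrow> 'a \<Rightarrow> bool) \<Rightarrow> 'a \<Rightarrow> 'a \<Rightarrow> real" where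
  "biharmonic_distance E u v =
     (let P = moore_penrose_inverse (laplacian E); P2 = P ** P
      in sqrt (P2 $ u $ u + P2 $ v $ v - 2 * P2 $ u $ v))"

text \<open>
  Eigenvalues and eigenvectors are indexed by \<open>{1..CARD('a)}\<close>. As there are \<open>CARD('a)\<close> orthonormal
  eigenvectors, \<open>lam\<close> necessarily lists all Laplacian eigenvalues with multiplicity.
\<close>

definition laplacian_eigensystem ::
    "('a::finite \<Rightarrow> 'a \<Rightarrow> bool) \<Rightarrow> (nat \<Rightarrow> real) \<Rightarrow> (nat \<Rightarrow> real ^ 'a) \<Rightarrow> bool" where
  "laplacian_eigensystem E lam z \<longleftrightarrow>
     mono_on {1..CARD('a)} lam \<and>
     (\<forall>i\<in>{1..CARD('a)}. laplacian E *v z i = lam i *\<^sub>R z i) \<and>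
     (\<forall>i\<in>{1..CARD('a)}. norm (z i) = 1) \<and>
     (\<forall>i\<in>{1..CARD('a)}. \<forall>j\<in>{1..CARD('a)}. i \<noteq> j \<longrightarrow> orthogonal (z i) (z j))"

end

theory Submission
  imports Defs
begin

text \<open>
  In an orthonormal eigenbasis \<open>w\<close> of a matrix with eigenvalues \<open>\<mu>\<close>, the pseudoinverse is
  \<open>\<Sum>i. inverse (\<mu> i) w\<^sub>i w\<^sub>i\<^sup>T\<close>, where the convention \<open>inverse 0 = 0\<close> takes care of the kernel.
  Its square gives the biharmonic distance as
  \<open>\<Sum>i. (inverse (\<mu> i))\<^sup>2 (w\<^sub>i(u) - w\<^sub>i(v))\<^sup>2\<close>. The Kronecker products of the two given
  eigenbases form such a basis for the Laplacian of the Cartesian product, with eigenvalues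
  \<open>\<lambda>\<^sub>i + \<lambda>\<^sub>j\<close>, and the constant eigenvector contributes nothing.
\<close>

text \<open>Both \<open>A ** X\<close> and \<open>A ** Y\<close> are the orthogonal projection onto
  the range of \<open>A\<close>, so they agree; likewise \<open>X ** A\<close> and
  \<open>Y ** A\<close>. Then \<open>X = X ** A ** X\<close> is recovered from these
  products.\<close>

lemma moore_penrose_inverse_unique:
  assumes "is_moore_penrose_inverse A X" and "is_moore_penrose_inverse A Y"
  shows "X = Y"
proof -
  have X: "A ** X ** A = A" "X ** A ** X = X"
      "transpose (A ** X) = A ** X" "transpose (X ** A) = X ** A"
    and Y: "A ** Y ** A = A" "Y ** A ** Y = Y"
      "transpose (A ** Y) = A ** Y" "transpose (Y ** A) = Y ** A"
    using assms by (auto simp: is_moore_penrose_inverse_def)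
  have "A ** X = (A ** Y) ** (A ** X)"
    using Y(1) by (simp add: matrix_mul_assoc)
  \<comment> \<open>Symmetry of both factors allows reversing their order, after which
    \<open>A ** X ** A = A\<close> absorbs \<open>X\<close>.\<close>
  also have "\<dots> = transpose ((A ** X) ** (A ** Y))"
    by (simp only: matrix_transpose_mul[of "A ** X" "A ** Y"] X(3) Y(3))
  also have "(A ** X) ** (A ** Y) = A ** Y"
    using X(1) by (simp add: matrix_mul_assoc)
  finally have AXY: "A ** X = A ** Y"
    by (simp only: Y(3))
  have "X ** A = (X ** A) ** (Y ** A)"
    using Y(1) by (metis matrix_mul_assoc)
  also have "\<dots> = transpose ((Y ** A) ** (X ** A))"
    by (simp only: matrix_transpose_mul[of "Y ** A" "X ** A"] X(4) Y(4))
  also have "(Y ** A) ** (X ** A) = Y ** A"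
    using X(1) by (metis matrix_mul_assoc)
  finally have XAY: "X ** A = Y ** A"
    by (simp only: Y(4))
  have "X = X ** (A ** X)"
    using X(2) by (simp add: matrix_mul_assoc)
  also have "\<dots> = Y ** A ** Y"
    by (simp add: AXY XAY matrix_mul_assoc)
  finally show ?thesis
    by (simp only: Y(2))
qed

lemma moore_penrose_inverse_eqI:
  assumes "is_moore_penrose_inverse A X"
  shows "moore_penrose_inverse A = X"
  unfolding moore_penrose_inverse_def
  using assms moore_penrose_inverse_unique by blast

text \<open>The index type is arbitrary so that pairs can index the eigenbasis of a product
  graph.\<close>

definition spectral_matrix ::
    "'i set \<Rightarrow> ('i \<Rightarrow> real ^ 'n) \<Rightarrow> ('i \<Rightarrow> real) \<Rightarrow> real ^ 'n ^ 'n" where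
  "spectral_matrix I w c = (\<chi> u v. \<Sum>i\<in>I. c i * w i $ u * w i $ v)"

lemma transpose_spectral_matrix: "transpose (spectral_matrix I w c) = spectral_matrix I w c"
  by (simp add: spectral_matrix_def transpose_def vec_eq_iff ac_simps)

definition orthonormal_on :: "'i set \<Rightarrow> ('i \<Rightarrow> 'v::real_inner) \<Rightarrow> bool" where
  "orthonormal_on I w \<longleftrightarrow> (\<forall>i\<in>I. \<forall>j\<in>I. w i \<bullet> w j = (if i = j then 1 else 0))"

text \<open>Orthonormality kills the cross terms, so matrix identities reduce to identities between
  coefficients.\<close>

lemma spectral_matrix_mult:
  fixes w :: "'i \<Rightarrow> real ^ 'n"
  assumes "finite I" and "orthonormal_on I w"
  shows "spectral_matrix I w c ** spectral_matrix I w d = spectral_matrix I w (\<lambda>i. c i * d i)"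
proof -
  have "(\<Sum>k\<in>UNIV. (\<Sum>i\<in>I. c i * w i $ u * w i $ k) * (\<Sum>j\<in>I. d j * w j $ k * w j $ v)) =
      (\<Sum>i\<in>I. c i * d i * w i $ u * w i $ v)" for u v
  proof -
    have "(\<Sum>k\<in>UNIV. (\<Sum>i\<in>I. c i * w i $ u * w i $ k) * (\<Sum>j\<in>I. d j * w j $ k * w j $ v)) =
        (\<Sum>k\<in>UNIV. \<Sum>i\<in>I. \<Sum>j\<in>I. c i * w i $ u * w i $ k * (d j * w j $ k * w j $ v))"
      by (simp add: sum_product)
    also have "\<dots> = (\<Sum>i\<in>I. \<Sum>j\<in>I. \<Sum>k\<in>UNIV. c i * w i $ u * w i $ k * (d j * w j $ k * w j $ v))"
      by (subst sum.swap, subst sum.swap[of _ _ UNIV]) (rule refl)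
    also have "\<dots> = (\<Sum>i\<in>I. \<Sum>j\<in>I. c i * w i $ u * d j * w j $ v * (w i \<bullet> w j))"
      by (simp add: inner_vec_def sum_distrib_left ac_simps)
    also have "\<dots> = (\<Sum>i\<in>I. \<Sum>j\<in>I. if i = j then c i * w i $ u * d j * w j $ v else 0)"
      using assms(2) by (intro sum.cong refl) (auto simp: orthonormal_on_def)
    also have "\<dots> = (\<Sum>i\<in>I. c i * d i * w i $ u * w i $ v)"
      using assms(1) by (simp add: ac_simps)
    finally show ?thesis .
  qed
  then show ?thesis
    by (simp add: spectral_matrix_def matrix_matrix_mult_def vec_eq_iff)
qed

lemma orthonormal_on_expand:
  fixes w :: "'i \<Rightarrow> 'v::euclidean_space"
  assumes "finite I" and "orthonormal_on I w" and "card I = DIM('v)"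
  shows "(\<Sum>i\<in>I. (w i \<bullet> x) *\<^sub>R w i) = x"
proof -
  have inj: "inj_on w I"
    using assms(2) by (auto simp: inj_on_def orthonormal_on_def) (metis zero_neq_one)
  have orth: "pairwise orthogonal (w ` I)"
    using assms(2) by (auto simp: pairwise_def orthonormal_on_def orthogonal_def)
  have norm: "norm b = 1" if "b \<in> w ` I" for b
    using that assms(2) by (auto simp: orthonormal_on_def norm_eq_1)
  then have "0 \<notin> w ` I"
    by fastforce
  then have "independent (w ` I)"
    using orth pairwise_orthogonal_independent by blast
  then have "span (w ` I) = UNIV"
    using card_ge_dim_independent[of "w ` I" UNIV] assms(3) card_image[OF inj] by auto
  then have "(\<Sum>b\<in>w ` I. (b \<bullet> x) *\<^sub>R b) = x"
    using orthonormal_basis_expand[OF orth norm] assms(1) by (simp add: inner_commute[of _ x])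
  then show ?thesis
    by (simp add: sum.reindex[OF inj])
qed

text \<open>A matrix is determined by its action on vectors, and each vector expands in the
  eigenbasis.\<close>

lemma spectral_matrix_eigenbasis:
  fixes A :: "real ^ 'n ^ 'n" and w :: "'i \<Rightarrow> real ^ 'n"
  assumes "finite I" and "orthonormal_on I w" and "card I = CARD('n)"
    and eigen: "\<And>i. i \<in> I \<Longrightarrow> A *v w i = \<mu> i *\<^sub>R w i"
  shows "A = spectral_matrix I w \<mu>"
proof -
  have "A *v x = spectral_matrix I w \<mu> *v x" for x
  proof -
    have "A *v x = A *v (\<Sum>i\<in>I. (w i \<bullet> x) *\<^sub>R w i)"
      using orthonormal_on_expand[of I w x] assms by simp
    also have "\<dots> = (\<Sum>i\<in>I. (w i \<bullet> x) *\<^sub>R \<mu> i *\<^sub>R w i)"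
      using eigen by (simp add: linear_sum[OF matrix_vector_mul_linear] o_def
        matrix_vector_mult_scaleR)
    also have "\<dots> = spectral_matrix I w \<mu> *v x"
      unfolding spectral_matrix_def matrix_vector_mult_def inner_vec_def
      by (simp add: vec_eq_iff sum_distrib_left sum_distrib_right)
        (subst sum.swap, simp add: ac_simps)
    finally show ?thesis .
  qed
  then show ?thesis
    by (simp add: matrix_eq)
qed

lemma is_moore_penrose_inverse_spectral_matrix:
  assumes "finite I" and "orthonormal_on I w"
  shows "is_moore_penrose_inverse (spectral_matrix I w \<mu>) (spectral_matrix I w (\<lambda>i. inverse (\<mu> i)))"
proof -
  \<comment> \<open>These are the first two Penrose equations for scalars; they hold at zero because
    \<open>inverse 0 = 0\<close>.\<close>
  have "(\<lambda>i. \<mu> i * inverse (\<mu> i) * \<mu> i) = \<mu>"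
    "(\<lambda>i. inverse (\<mu> i) * \<mu> i * inverse (\<mu> i)) = (\<lambda>i. inverse (\<mu> i))"
    by (simp_all add: fun_eq_iff field_simps)
  then show ?thesis
    by (simp only: is_moore_penrose_inverse_def spectral_matrix_mult[OF assms]
        transpose_spectral_matrix simp_thms)
qed

lemma biharmonic_distance_eigenbasis:
  fixes E :: "'a::finite \<Rightarrow> 'a \<Rightarrow> bool" and w :: "'i \<Rightarrow> real ^ 'a"
  assumes "finite I" and "orthonormal_on I w" and "card I = CARD('a)"
    and "\<And>i. i \<in> I \<Longrightarrow> laplacian E *v w i = \<mu> i *\<^sub>R w i"
  shows "biharmonic_distance E u v = sqrt (\<Sum>i\<in>I. \<mu> i powi (-2) * (w i $ u - w i $ v)\<^sup>2)"
proof -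
  have "moore_penrose_inverse (laplacian E) = spectral_matrix I w (\<lambda>i. inverse (\<mu> i))"
    using spectral_matrix_eigenbasis[of I w "laplacian E" \<mu>] assms
      is_moore_penrose_inverse_spectral_matrix[of I w \<mu>]
    by (intro moore_penrose_inverse_eqI) simp
  then have "biharmonic_distance E u v =
      sqrt (spectral_matrix I w (\<lambda>i. inverse (\<mu> i) * inverse (\<mu> i)) $ u $ u +
        spectral_matrix I w (\<lambda>i. inverse (\<mu> i) * inverse (\<mu> i)) $ v $ v -
        2 * spectral_matrix I w (\<lambda>i. inverse (\<mu> i) * inverse (\<mu> i)) $ u $ v)"
    using spectral_matrix_mult[OF assms(1,2)] by (simp add: biharmonic_distance_def Let_def)
  \<comment> \<open>The three entries share their coefficients, so they combine termwise into a
    squared difference.\<close>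
  also have "\<dots> = sqrt (\<Sum>i\<in>I. inverse (\<mu> i) * inverse (\<mu> i) * (w i $ u - w i $ v)\<^sup>2)"
    by (simp add: spectral_matrix_def sum_distrib_left flip: sum.distrib sum_subtractf)
      (simp add: power2_eq_square algebra_simps)
  \<comment> \<open>This includes zero eigenvalues, since \<open>0 powi (-2) = 0\<close>.\<close>
  also have "(\<Sum>i\<in>I. inverse (\<mu> i) * inverse (\<mu> i) * (w i $ u - w i $ v)\<^sup>2) =
      (\<Sum>i\<in>I. \<mu> i powi (-2) * (w i $ u - w i $ v)\<^sup>2)"
    by (simp add: power_int_def power2_eq_square)
  finally show ?thesis .
qed

text \<open>The form as a sum over neighbours suits the product graph, whose neighbourhoods split by
  coordinate.\<close>

lemma laplacian_mult_vec:
  "(laplacian E *v x) $ u = (\<Sum>v | E u v. x $ u - x $ v)"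
proof -
  have "(laplacian E *v x) $ u =
      (\<Sum>v\<in>UNIV. (if u = v then real (card {w. E u w}) * x $ v else 0) - (if E u v then x $ v else 0))"
    by (auto simp: laplacian_def degree_matrix_def adjacency_matrix_def matrix_vector_mult_def
        algebra_simps intro!: sum.cong)
  also have "\<dots> = real (card {w. E u w}) * x $ u - (\<Sum>v | E u v. x $ v)"
    by (simp add: sum_subtractf sum.If_cases)
  finally show ?thesis
    by (simp add: sum_subtractf)
qed

lemma sum_cartesian_product_neighbours:
  assumes "simple_graph E1"
  shows "(\<Sum>v | cartesian_product E1 E2 (u1, u2) v. f v) =
    (\<Sum>v1 | E1 u1 v1. f (v1, u2)) + (\<Sum>v2 | E2 u2 v2. f (u1, v2))"
proof -
  have "{v. cartesian_product E1 E2 (u1, u2) v} =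
      (\<lambda>v1. (v1, u2)) ` {v1. E1 u1 v1} \<union> (\<lambda>v2. (u1, v2)) ` {v2. E2 u2 v2}"
    by (auto simp: cartesian_product_def)
  \<comment> \<open>A common element could only be \<open>(u1, u2)\<close>, which would make
    \<open>u1\<close> its own neighbour in \<open>E1\<close>.\<close>
  moreover have "(\<lambda>v1. (v1, u2)) ` {v1. E1 u1 v1} \<inter> (\<lambda>v2. (u1, v2)) ` {v2. E2 u2 v2} = {}"
    using assms by (auto simp: simple_graph_def irreflp_def)
  ultimately show ?thesis
    by (simp add: sum.union_disjoint sum.reindex inj_on_def)
qed

definition kronecker_vec :: "real ^ 'a \<Rightarrow> real ^ 'b \<Rightarrow> real ^ ('a \<times> 'b)" where
  "kronecker_vec x y = (\<chi> u. x $ fst u * y $ snd u)"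

lemma inner_kronecker_vec:
  fixes x x' :: "real ^ 'a::finite" and y y' :: "real ^ 'b::finite"
  shows "kronecker_vec x y \<bullet> kronecker_vec x' y' = (x \<bullet> x') * (y \<bullet> y')"
  by (simp add: kronecker_vec_def inner_vec_def sum_product sum.cartesian_product
      case_prod_unfold ac_simps)

text \<open>A move along one coordinate leaves the other factor fixed, so the Laplacian of the
  product acts on each factor separately and the two eigenvalues add.\<close>

lemma laplacian_kronecker_vec:
  assumes "simple_graph E1" and "laplacian E1 *v x = a *\<^sub>R x" and "laplacian E2 *v y = b *\<^sub>R y"
  shows "laplacian (cartesian_product E1 E2) *v kronecker_vec x y = (a + b) *\<^sub>R kronecker_vec x y"
proof -
  have "(laplacian (cartesian_product E1 E2) *v kronecker_vec x y) $ (u1, u2) =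
      (a + b) * (x $ u1 * y $ u2)" for u1 u2
  proof -
    have "(laplacian (cartesian_product E1 E2) *v kronecker_vec x y) $ (u1, u2) =
        (\<Sum>v1 | E1 u1 v1. x $ u1 - x $ v1) * y $ u2 + x $ u1 * (\<Sum>v2 | E2 u2 v2. y $ u2 - y $ v2)"
      by (simp add: laplacian_mult_vec sum_cartesian_product_neighbours[OF assms(1)]
          kronecker_vec_def sum_distrib_left sum_distrib_right algebra_simps)
    also have "\<dots> = (a *\<^sub>R x) $ u1 * y $ u2 + x $ u1 * (b *\<^sub>R y) $ u2"
      by (simp only: flip: laplacian_mult_vec assms(2,3))
    finally show ?thesis
      by (simp add: algebra_simps)
  qed
  then show ?thesis
    by (simp add: vec_eq_iff kronecker_vec_def)
qed

lemma orthonormal_on_eigensystem: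
  fixes E :: "'a::finite \<Rightarrow> 'a \<Rightarrow> bool"
  assumes "laplacian_eigensystem E lam z"
  shows "orthonormal_on {1..CARD('a)} z"
  using assms by (auto simp: laplacian_eigensystem_def orthonormal_on_def orthogonal_def norm_eq_1)

theorem theorem5p3:
  fixes E1 :: "'a::finite \<Rightarrow> 'a \<Rightarrow> bool" and E2 :: "'b::finite \<Rightarrow> 'b \<Rightarrow> bool"
    and lam1 lam2 :: "nat \<Rightarrow> real"
    and z1 :: "nat \<Rightarrow> real ^ 'a" and z2 :: "nat \<Rightarrow> real ^ 'b"
    and u1 v1 :: 'a and u2 v2 :: 'b
  assumes "simple_graph E1" and "simple_graph E2"
    and "laplacian_eigensystem E1 lam1 z1" and "laplacian_eigensystem E2 lam2 z2"
    and "z1 1 = (\<chi> u. 1 / sqrt (real CARD('a)))"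
    and "z2 1 = (\<chi> u. 1 / sqrt (real CARD('b)))"
    and "connected_graph (cartesian_product E1 E2)"
  shows "biharmonic_distance (cartesian_product E1 E2) (u1, u2) (v1, v2) =
    sqrt (\<Sum>(i, j)\<in>{1..CARD('a)} \<times> {1..CARD('b)} - {(1, 1)}.
      (lam1 i + lam2 j) powi (-2) * (z1 i $ u1 * z2 j $ u2 - z1 i $ v1 * z2 j $ v2)\<^sup>2)"
proof -
  let ?I = "{1..CARD('a)} \<times> {1..CARD('b)}"
  define w where "w = (\<lambda>(i, j). kronecker_vec (z1 i) (z2 j))"
  define \<mu> where "\<mu> = (\<lambda>(i, j). lam1 i + lam2 j)"
  let ?t = "\<lambda>p. \<mu> p powi (-2) * (w p $ (u1, u2) - w p $ (v1, v2))\<^sup>2"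
  have "orthonormal_on ?I w"
    using orthonormal_on_eigensystem[OF assms(3)] orthonormal_on_eigensystem[OF assms(4)]
    unfolding orthonormal_on_def w_def by (auto simp: inner_kronecker_vec)
  moreover have "laplacian (cartesian_product E1 E2) *v w p = \<mu> p *\<^sub>R w p" if "p \<in> ?I" for p
    using that assms(1,3,4)
    by (auto simp: w_def \<mu>_def laplacian_eigensystem_def intro!: laplacian_kronecker_vec)
  ultimately have "biharmonic_distance (cartesian_product E1 E2) (u1, u2) (v1, v2) = sqrt (sum ?t ?I)"
    by (intro biharmonic_distance_eigenbasis) auto
  \<comment> \<open>The vector \<open>w (1, 1)\<close> is constant, so its difference at the two
    vertices is zero whatever the coefficient.\<close>
  also have "sum ?t ?I = sum ?t (?I - {(1, 1)})"
    using assms(5,6) by (intro sum.mono_neutral_right) (auto simp: w_def kronecker_vec_def)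
  finally show ?thesis
    by (simp add: w_def \<mu>_def kronecker_vec_def case_prod_unfold)
qed

end
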